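(* Let $k>0$. For all $\lambda,x\in\mathbb{V}$, $$(\tau(\lambda)-k^2)\,G_k(\lambda,x)=D_k\big(F_k(\lambda,\cdot)\big)(x)+D_k^*\big(F_k^*(\lambda,\cdot)\big)(x),$$ where $\tau(\lambda)=\lambda_1^2+\lambda_2^2+\lambda_1\lambda_2$ and $$D_k=(\lambda_1-\lambda_3+2k)\,T_{\pi(e_1)}+(\lambda_2-\lambda_3+k)\,T_{\pi(e_2)}+\tau(\lambda)+k(\lambda_1-\lambda_3)+k^2,$$ $$D_k^*=(\lambda_1-\lambda_3-2k)\,T_{\pi(e_1)}+(\lambda_2-\lambda_3-k)\,T_{\pi(e_2)}+\tau(\lambda)-k(\lambda_1-\lambda_3)+k^2.$$
   Context: Let $\mathbb{V}=\{x\in\mathbb{R}^3:x_1+x_2+x_3=0\}$, $\mathbb{V}_{\mathbb{C}}$ its complexification, $\langle\cdot,\cdot\rangle$ the standard inner product, $(e_1,e_2,e_3)$ the standard basis of $\mathbb{R}^3$, $\pi$ the orthogonal projection onto $\mathbb{V}$, so $\pi(e_1)=(\frac23,-\frac13,-\frac13)$ and $\pi(e_2)=(-\frac13,\frac23,-\frac13)$. The group $S_3$ acts by permuting coordinates and $\det(w)$ is the sign of $w$. Fix $k>0$, $\rho_k=k(e_1-e_3)$. For $\xi\in\mathbb{R}^3$ the Dunkl-Cherednik operator is $$T_\xi=\partial_\xi+k\sum_{1\le i<j\le3}(\xi_i-\xi_j)\frac{1-s_{i,j}}{1-e^{x_j-x_i}}-\langle\rho_k,\xi\rangle,$$ where $s_{i,j}$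 acts on functions of $x$ by interchanging $x_i$ and $x_j$ (the quotients being extended smoothly across $x_i=x_j$). The operators act in the variable $x$. The nonsymmetric Opdam hypergeometric function $G_k(\lambda,\cdot)$ is the unique solution, holomorphic on a tubular neighborhood of $\mathbb{V}$ in $\mathbb{V}_{\mathbb{C}}$, of $T_\xi G_k(\lambda,\cdot)=\langle\lambda,\xi\rangle G_k(\lambda,\cdot)$ for all $\xi\in\mathbb{V}$, with $G_k(\lambda,0)=1$. The Heckman-Opdam hypergeometric function and its antisymmetric analogue are $$F_k(\lambda,x)=\frac16\sum_{w\in S_3}G_k(\lambda,wx),\qquad F_k^*(\lambda,x)=\frac16\sum_{w\in S_3}\det(w)\,G_k(\lambda,wx).$$ *)

theory Defs
  imports "HOL-Analysis.Analysis"
begin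

definition VV :: "(real ^ 3) set" where
  "VV = {x. x $ 1 + x $ 2 + x $ 3 = 0}"

definition VC :: "(complex ^ 3) set" where
  "VC = {z. z $ 1 + z $ 2 + z $ 3 = 0}"

definition complexify :: "real ^ 3 \<Rightarrow> complex ^ 3" where
  "complexify x = (\<chi> i. complex_of_real (x $ i))"

definition Im_vec :: "complex ^ 3 \<Rightarrow> real ^ 3" where
  "Im_vec z = (\<chi> i. Im (z $ i))"

definition proj_VV :: "real ^ 3 \<Rightarrow> real ^ 3" where
  "proj_VV x = x - (\<chi> i. (x $ 1 + x $ 2 + x $ 3) / 3)"

lemma proj_VV_in: "proj_VV x \<in> VV"
  by (simp add: proj_VV_def VV_def field_simps)

lemma proj_VV_orthogonal:
  assumes "v \<in> VV"
  shows "(x - proj_VV x) \<bullet> v = 0"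
proof -
  have "(x - proj_VV x) \<bullet> v = (x $ 1 + x $ 2 + x $ 3) / 3 * (v $ 1 + v $ 2 + v $ 3)"
    by (simp add: proj_VV_def inner_vec_def sum_3 algebra_simps add_divide_distrib)
  then show ?thesis
    using assms by (simp add: VV_def)
qed

lemma proj_VV_axis:
  "proj_VV (axis 1 1) = vector [2/3, -1/3, -1/3]"
  "proj_VV (axis 2 1) = vector [-1/3, 2/3, -1/3]"
  by (simp_all add: proj_VV_def vec_eq_iff forall_3 axis_def vector_3)

definition perm_act :: "(3 \<Rightarrow> 3) \<Rightarrow> real ^ 3 \<Rightarrow> real ^ 3" where
  "perm_act w x = (\<chi> i. x $ inv w i)"

definition rho :: "real \<Rightarrow> real ^ 3" where
  "rho k = k *\<^sub>R (axis 1 1 - axis 3 1)"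

text \<open>
  Functions on \<^term>\<open>VV\<close> are represented by functions on all of \<open>R\<^sup>3\<close>, of which only the
  values on \<^term>\<open>VV\<close> matter.  On the hyperplane \<open>x\<^sub>i = x\<^sub>j\<close> the difference quotient takes its
  limiting value, the limit being taken inside the translate \<open>x + VV\<close>; for \<open>x \<in> VV\<close> and
  \<open>\<xi> \<in> VV\<close> the operator \<open>dunkl_cherednik k \<xi> f x\<close> therefore depends on the restriction of
  \<open>f\<close> to \<^term>\<open>VV\<close> alone.
\<close>

definition refl_quot :: "3 \<Rightarrow> 3 \<Rightarrow> (real ^ 3 \<Rightarrow> complex) \<Rightarrow> real ^ 3 \<Rightarrow> complex" where
  "refl_quot i j f x =
     (let q = (\<lambda>y. (f y - f (perm_act (Transposition.transpose i j) y)) / complex_of_real (1 - exp (y $ j - y $ i)))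
      in if x $ i \<noteq> x $ j then q x
         else Lim (at x within {y. y - x \<in> VV \<and> y $ i \<noteq> y $ j}) q)"

text \<open>
  The pairs \<open>i < j\<close> are listed explicitly because in the numeral type \<open>3\<close> the literal \<open>3\<close> equals \<open>0\<close>
  and is therefore the least element.
\<close>

definition dunkl_cherednik :: "real \<Rightarrow> real ^ 3 \<Rightarrow> (real ^ 3 \<Rightarrow> complex) \<Rightarrow> real ^ 3 \<Rightarrow> complex" where
  "dunkl_cherednik k \<xi> f x =
     vector_derivative (\<lambda>t. f (x + t *\<^sub>R \<xi>)) (at 0)
     + k *\<^sub>R (\<Sum>(i, j)\<in>{(1, 2), (1, 3), (2, 3)}. (\<xi> $ i - \<xi> $ j) *\<^sub>R refl_quot i j f x)
     - (rho k \<bullet> \<xi>) *\<^sub>R f x"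

definition holomorphic_on_VC :: "(complex ^ 3 \<Rightarrow> complex) \<Rightarrow> (complex ^ 3) set \<Rightarrow> bool" where
  "holomorphic_on_VC H U \<longleftrightarrow>
     (\<forall>z\<in>U. \<exists>L. (H has_derivative L) (at z within U) \<and> Vector_Spaces.linear (*s) (*) L)"

definition tube :: "(real ^ 3) set \<Rightarrow> (complex ^ 3) set" where
  "tube \<Omega> = {z \<in> VC. Im_vec z \<in> \<Omega>}"

text \<open>
  \<open>is_opdam_G k lam g\<close>: on \<^term>\<open>VV\<close>, \<open>g\<close> is the nonsymmetric Opdam hypergeometric function
  \<open>G\<^sub>k(lam, \<cdot>)\<close>, i.e. the solution of the normalized eigenvalue problem that extends
  holomorphically to a tubular neighbourhood \<open>VV + i \<Omega>\<close> of \<^term>\<open>VV\<close> in \<^term>\<open>VC\<close>.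
\<close>

definition is_opdam_G :: "real \<Rightarrow> real ^ 3 \<Rightarrow> (real ^ 3 \<Rightarrow> complex) \<Rightarrow> bool" where
  "is_opdam_G k lam g \<longleftrightarrow>
     (\<exists>\<Omega> H. openin (top_of_set VV) \<Omega> \<and> 0 \<in> \<Omega> \<and> holomorphic_on_VC H (tube \<Omega>)
        \<and> (\<forall>x\<in>VV. g x = H (complexify x)))
     \<and> (\<forall>\<xi>\<in>VV. \<forall>x\<in>VV. dunkl_cherednik k \<xi> g x = (lam \<bullet> \<xi>) *\<^sub>R g x)
     \<and> g 0 = 1"

text \<open>Applied to \<open>g = G\<^sub>k(lam, \<cdot>)\<close>, these give \<open>F\<^sub>k(lam, \<cdot>)\<close> and \<open>F\<^sub>k\<^sup>*(lam, \<cdot>)\<close>.\<close>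

definition sym_avg :: "(real ^ 3 \<Rightarrow> complex) \<Rightarrow> real ^ 3 \<Rightarrow> complex" where
  "sym_avg g x = (1 / 6) * (\<Sum>w | w permutes (UNIV :: 3 set). g (perm_act w x))"

definition antisym_avg :: "(real ^ 3 \<Rightarrow> complex) \<Rightarrow> real ^ 3 \<Rightarrow> complex" where
  "antisym_avg g x =
     (1 / 6) * (\<Sum>w | w permutes (UNIV :: 3 set). of_int (sign w) * g (perm_act w x))"

definition tau :: "real ^ 3 \<Rightarrow> real" where
  "tau lam = (lam $ 1)\<^sup>2 + (lam $ 2)\<^sup>2 + lam $ 1 * lam $ 2"

definition Dop :: "real \<Rightarrow> real ^ 3 \<Rightarrow> (real ^ 3 \<Rightarrow> complex) \<Rightarrow> real ^ 3 \<Rightarrow> complex" where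
  "Dop k lam f x =
     (lam $ 1 - lam $ 3 + 2 * k) *\<^sub>R dunkl_cherednik k (proj_VV (axis 1 1)) f x
     + (lam $ 2 - lam $ 3 + k) *\<^sub>R dunkl_cherednik k (proj_VV (axis 2 1)) f x
     + (tau lam + k * (lam $ 1 - lam $ 3) + k\<^sup>2) *\<^sub>R f x"

definition Dop_star :: "real \<Rightarrow> real ^ 3 \<Rightarrow> (real ^ 3 \<Rightarrow> complex) \<Rightarrow> real ^ 3 \<Rightarrow> complex" where
  "Dop_star k lam f x =
     (lam $ 1 - lam $ 3 - 2 * k) *\<^sub>R dunkl_cherednik k (proj_VV (axis 1 1)) f x
     + (lam $ 2 - lam $ 3 - k) *\<^sub>R dunkl_cherednik k (proj_VV (axis 2 1)) f x
     + (tau lam - k * (lam $ 1 - lam $ 3) + k\<^sup>2) *\<^sub>R f x"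

end

theory Submission
  imports Defs "HOL-Complex_Analysis.Cauchy_Integral_Formula"
begin

text \<open>
  The operators \<open>D\<^sub>k\<close> and \<open>D\<^sub>k\<^sup>*\<close> project the span of the six functions \<open>x \<mapsto> G(w x)\<close> back
  onto \<open>G\<close>, and this is a statement about six scalars.

  Write \<open>g = G\<^sub>k(\<lambda>, \<cdot>)\<close>, \<open>\<rho> = \<rho>\<^sub>k\<close>, and let \<open>\<epsilon>\<close> be the trivial character of \<open>S\<^sub>3\<close> (with \<open>\<eta> = 1\<close>) or
  the sign (with \<open>\<eta> = -1\<close>), so that \<open>\<eta>\<close> is the value of \<open>\<epsilon>\<close> on reflections.  Put
  \<open>F\<^sub>\<epsilon>(x) = 1/6 \<Sum>\<^sub>w \<epsilon>(w) g(w x)\<close>.  At a point with distinct coordinates the eigenvalue equation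
  expresses every directional derivative of \<open>g\<close> at \<open>w x\<close> through the values of \<open>g\<close> on the orbit
  of \<open>x\<close>, with coefficients that involve \<open>c\<^sub>i\<^sub>j = 1/(1 - exp(x\<^sub>j - x\<^sub>i))\<close>.  Because
  \<open>c\<^sub>i\<^sub>j + c\<^sub>j\<^sub>i = 1\<close>, pairing \<open>w\<close> with \<open>s\<^sub>i\<^sub>j w\<close> removes these functions from \<open>T\<^sub>\<xi> F\<^sub>\<epsilon>\<close>, and what
  remains (lemma \<open>dunkl_cherednik_signed_avg\<close>) has constant coefficients:
  \<open>T\<^sub>\<xi> F\<^sub>\<epsilon>(x) = 1/6 \<Sum>\<^sub>w \<epsilon>(w) (\<langle>\<lambda> - \<eta>\<rho>, w\<xi>\<rangle> - \<eta>\<langle>\<rho>, \<xi>\<rangle>) g(w x)\<close>.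

  The first-order parts of \<open>D\<^sub>k\<close> and \<open>D\<^sub>k\<^sup>*\<close> are \<open>T\<^sub>\<mu>\<close> for \<open>\<mu> = \<lambda> + \<eta>\<rho>\<close>.  Since \<open>|\<lambda>|\<^sup>2 = 2\<tau>(\<lambda>)\<close> and
  \<open>|\<rho>|\<^sup>2 = 2k\<^sup>2\<close>, the coefficient of \<open>g(w x)/6\<close> in the asserted right-hand side is
  \<open>\<langle>\<lambda> - \<rho>, w(\<lambda> + \<rho>)\<rangle> + det(w) \<langle>\<lambda> + \<rho>, w(\<lambda> - \<rho>)\<rangle> + (1 + det w)(\<tau>(\<lambda>) - k\<^sup>2)\<close>.  For the identity it is
  \<open>6(\<tau>(\<lambda>) - k\<^sup>2)\<close>.  For a reflection the two inner products agree and cancel, as \<open>w\<close> is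
  self-adjoint.  For a rotation by 120 degrees \<open>\<langle>v, w v\<rangle> = -|v|\<^sup>2/2\<close> for every \<open>v\<close> in the plane and
  the mixed terms cancel, so the coefficient vanishes again (lemma \<open>orbit_coefficient\<close>).

  Points on the reflection lines are reached by continuity.  Cauchy's estimate turns the
  holomorphic extension of \<open>g\<close> into continuity of its directional derivatives (\<open>opdam_G_C1\<close>),
  and for such functions the limits that define the difference quotients on the reflection lines
  exist, so Dunkl-Cherednik operators give functions that are continuous along points with
  distinct coordinates (\<open>dunkl_cherednik_tendsto\<close>).
\<close>

section \<open>The plane and its orbits\<close>

definition dirderiv :: "real ^ 3 \<Rightarrow> (real ^ 3 \<Rightarrow> complex) \<Rightarrow> real ^ 3 \<Rightarrow> complex" where
  "dirderiv \<xi> f x = vector_derivative (\<lambda>t. f (x + t *\<^sub>R \<xi>)) (at 0)"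

text \<open>
  Only directions inside \<^term>\<open>VV\<close> occur, so that the notion depends on the restriction of the
  function to \<^term>\<open>VV\<close> alone, as it must for representatives with arbitrary values elsewhere.
\<close>

definition C1_on_VV :: "(real ^ 3 \<Rightarrow> complex) \<Rightarrow> bool" where
  "C1_on_VV f \<longleftrightarrow> continuous_on VV f \<and> (\<forall>\<xi>\<in>VV.
     (\<forall>x\<in>VV. ((\<lambda>t. f (x + t *\<^sub>R \<xi>)) has_vector_derivative dirderiv \<xi> f x) (at 0)) \<and>
     continuous_on VV (dirderiv \<xi> f))"

definition regular_points :: "(real ^ 3) set" where
  "regular_points = {x \<in> VV. \<forall>i j. i \<noteq> j \<longrightarrow> x $ i \<noteq> x $ j}"

lemma line_in_VV:
  assumes "x \<in> VV" "\<xi> \<in> VV"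
  shows "x + t *\<^sub>R \<xi> \<in> VV"
proof -
  have "(x + t *\<^sub>R \<xi>) $ 1 + (x + t *\<^sub>R \<xi>) $ 2 + (x + t *\<^sub>R \<xi>) $ 3
      = (x $ 1 + x $ 2 + x $ 3) + t * (\<xi> $ 1 + \<xi> $ 2 + \<xi> $ 3)"
    by (simp add: algebra_simps)
  then show ?thesis using assms by (simp add: VV_def)
qed

lemma root_in_VV: "i \<noteq> j \<Longrightarrow> (axis i 1 - axis j 1 :: real ^ 3) \<in> VV"
  using exhaust_3[of i] exhaust_3[of j] by (auto simp: VV_def axis_def)

lemma perm_act_in_VV: "w permutes UNIV \<Longrightarrow> x \<in> VV \<Longrightarrow> perm_act w x \<in> VV"
proof -
  assume w: "w permutes UNIV" and x: "x \<in> VV"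
  have "(\<Sum>i\<in>UNIV. x $ inv w i) = (\<Sum>i\<in>UNIV. x $ i)"
    by (rule sum.reindex_bij_betw) (use w permutes_inv permutes_imp_bij in blast)
  then show ?thesis using x by (simp add: VV_def perm_act_def sum_3)
qed

lemma perm_act_line: "perm_act w (x + t *\<^sub>R \<xi>) = perm_act w x + t *\<^sub>R perm_act w \<xi>"
  by (simp add: perm_act_def vec_eq_iff)

lemma perm_act_compose:
  assumes "v permutes UNIV" "w permutes UNIV"
  shows "perm_act (v \<circ> w) x = perm_act v (perm_act w x)"
proof -
  have "inv (v \<circ> w) = inv w \<circ> inv v"
    using assms by (intro o_inv_distrib permutes_bij)
  then show ?thesis by (simp add: perm_act_def)
qed

lemma norm_perm_act: assumes "w permutes UNIV" shows "norm (perm_act w x) = norm x"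
proof -
  have "(\<Sum>i\<in>UNIV. (x $ inv w i)\<^sup>2) = (\<Sum>i\<in>UNIV. (x $ i)\<^sup>2)"
    by (rule sum.reindex_bij_betw) (use assms permutes_inv permutes_imp_bij in blast)
  then show ?thesis by (simp add: norm_vec_def L2_set_def perm_act_def)
qed

lemma transpose_act_nth [simp]:
  "perm_act (Transposition.transpose i j) x $ l = x $ Transposition.transpose i j l"
  by (simp add: perm_act_def)

lemma transpose_act_decomp:
  fixes i j :: 3
  assumes "i \<noteq> j"
  shows "y = perm_act (Transposition.transpose i j) y + (y $ i - y $ j) *\<^sub>R (axis i 1 - axis j 1)"
  using assms by (auto simp: vec_eq_iff axis_def Transposition.transpose_def)

section \<open>Continuity of the derivatives of the hypergeometric function\<close>

lemma complex_line_in_tube: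
  assumes "x \<in> VV" and "\<xi> \<in> VV" and "Im z *\<^sub>R \<xi> \<in> \<Omega>"
  shows "complexify x + z *s complexify \<xi> \<in> tube \<Omega>"
proof -
  let ?p = "complexify x + z *s complexify \<xi>"
  have "Im_vec ?p = Im z *\<^sub>R \<xi>"
    by (simp add: Im_vec_def complexify_def vec_eq_iff)
  moreover have "?p $ 1 + ?p $ 2 + ?p $ 3
      = of_real (x$1 + x$2 + x$3) + z * of_real (\<xi>$1 + \<xi>$2 + \<xi>$3)"
    by (simp add: complexify_def algebra_simps)
  then have "?p \<in> VC"
    unfolding VC_def using assms(1,2) by (simp add: VV_def del: of_real_add)
  ultimately show ?thesis using assms(3) by (simp add: tube_def)
qed

lemma holomorphic_line:
  assumes H: "holomorphic_on_VC H (tube \<Omega>)" and x: "x \<in> VV" and \<xi>: "\<xi> \<in> VV"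
    and r: "\<And>s. \<bar>s\<bar> < r \<Longrightarrow> s *\<^sub>R \<xi> \<in> \<Omega>"
  shows "(\<lambda>z. H (complexify x + z *s complexify \<xi>)) holomorphic_on ball 0 r"
  unfolding holomorphic_on_def
proof
  fix z :: complex assume z: "z \<in> ball 0 r"
  let ?p = "\<lambda>z. complexify x + z *s complexify \<xi>"
  have mem: "?p u \<in> tube \<Omega>" if "u \<in> ball 0 r" for u
    using that abs_Im_le_cmod[of u] by (intro complex_line_in_tube x \<xi> r) simp
  obtain L where L: "(H has_derivative L) (at (?p z) within tube \<Omega>)"
    and lin: "Vector_Spaces.linear (*s) (*) L"
    using H mem[OF z] unfolding holomorphic_on_VC_def by blast
  have p: "(?p has_derivative (\<lambda>u. u *s complexify \<xi>)) (at z within ball 0 r)"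
  proof -
    have "bounded_linear (\<lambda>u::complex. u *s complexify \<xi>)"
      by (intro linear_conv_bounded_linear[THEN iffD1] linearI)
         (auto simp: vec_eq_iff algebra_simps)
    from bounded_linear.has_derivative[OF this has_derivative_ident]
    show ?thesis by (auto intro!: derivative_eq_intros)
  qed
  have "(H has_derivative L) (at (?p z) within ?p ` ball 0 r)"
    by (rule has_derivative_subset[OF L]) (use mem in blast)
  from diff_chain_within[OF p this]
  have "((\<lambda>u. H (?p u)) has_derivative (\<lambda>u. L (u *s complexify \<xi>))) (at z within ball 0 r)"
    by (simp add: o_def)
  moreover have "L (u *s complexify \<xi>) = L (complexify \<xi>) * u" for u
    using lin by (simp add: Vector_Spaces.linear_iff)
  ultimately show "(\<lambda>z. H (?p z)) field_differentiable at z within ball 0 r"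
    by (auto simp: field_differentiable_def has_field_derivative_def)
qed

text \<open>
  Restricting the holomorphic extension to the complex lines \<open>z \<mapsto> x + z \<xi>\<close> gives functions \<open>h\<^sub>x\<close> of
  one variable on a disc whose radius does not depend on \<open>x\<close>, and \<open>h\<^sub>x'(0)\<close> is the derivative in
  the direction \<open>\<xi>\<close>.  As \<open>y \<rightarrow> x\<close>, \<open>h\<^sub>y \<rightarrow> h\<^sub>x\<close> uniformly on a smaller disc, and Cauchy's estimate
  carries this over to the derivatives at the centre.
\<close>

lemma opdam_G_C1:
  assumes "is_opdam_G k lam g"
  shows "C1_on_VV g"
proof -
  obtain \<Omega> H where \<Omega>: "openin (top_of_set VV) \<Omega>" "0 \<in> \<Omega>"
    and H: "holomorphic_on_VC H (tube \<Omega>)" and gH: "\<And>x. x \<in> VV \<Longrightarrow> g x = H (complexify x)"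
    using assms unfolding is_opdam_G_def by blast
  obtain e where e: "e > 0" "ball 0 e \<inter> VV \<subseteq> \<Omega>"
    using \<Omega> unfolding openin_contains_ball by blast
  have contH: "continuous_on (tube \<Omega>) H"
    using H unfolding holomorphic_on_VC_def
    by (metis continuous_on_eq_continuous_within has_derivative_continuous)
  (* The vanishing summand puts x in the shape of a point on a complex line. *)
  have "continuous_on VV (\<lambda>x. H (complexify x + 0 *s complexify 0))"
  proof (rule continuous_on_compose2[OF contH])
    show "continuous_on VV (\<lambda>x. complexify x + 0 *s complexify 0)"
      unfolding complexify_def vector_scalar_mult_def by (intro continuous_intros)
    show "(\<lambda>x. complexify x + 0 *s complexify 0) ` VV \<subseteq> tube \<Omega>"
    proof (rule image_subsetI)
      fix y assume "y \<in> VV"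
      then show "complexify y + 0 *s complexify 0 \<in> tube \<Omega>"
        by (rule complex_line_in_tube) (use \<Omega>(2) in \<open>auto simp: VV_def\<close>)
    qed
  qed
  then have "continuous_on VV g" by (subst continuous_on_cong[OF refl gH]) auto
  moreover
  have "(\<forall>x\<in>VV. ((\<lambda>t. g (x + t *\<^sub>R \<xi>)) has_vector_derivative dirderiv \<xi> g x) (at 0)) \<and>
     continuous_on VV (dirderiv \<xi> g)" if \<xi>: "\<xi> \<in> VV" for \<xi>
  proof -
    (* With this radius the imaginary part of x + z xi stays inside Omega for all |z| < r. *)
    define r where "r = e / (norm \<xi> + 1)"
    have r: "r > 0" using e by (simp add: r_def add_nonneg_pos)
    have "norm (s *\<^sub>R \<xi>) < e" if "\<bar>s\<bar> < r" for s
    proof -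
      have "\<bar>s\<bar> * norm \<xi> \<le> \<bar>s\<bar> * (norm \<xi> + 1)" by (simp add: algebra_simps)
      also have "\<dots> < r * (norm \<xi> + 1)" using that
        by (intro mult_strict_right_mono) (auto simp: add_nonneg_pos)
      also have "\<dots> = e" by (simp add: r_def add_nonneg_eq_0_iff)
      finally show ?thesis by simp
    qed
    moreover have "s *\<^sub>R \<xi> \<in> VV" for s using line_in_VV[of 0 \<xi> s] \<xi> by (simp add: VV_def)
    ultimately have rs: "s *\<^sub>R \<xi> \<in> \<Omega>" if "\<bar>s\<bar> < r" for s
      using e(2) that by auto
    define h where "h x z = H (complexify x + z *s complexify \<xi>)" for x z
    have hol: "h x holomorphic_on ball 0 r" if "x \<in> VV" for x
      unfolding h_def by (rule holomorphic_line[OF H that \<xi> rs])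
    have der: "((\<lambda>t. g (x + t *\<^sub>R \<xi>)) has_vector_derivative deriv (h x) 0) (at 0)" if "x \<in> VV" for x
    proof -
      have "(h x has_field_derivative deriv (h x) 0) (at (of_real 0))"
        using holomorphic_derivI[OF hol[OF that]] r by simp
      then have "((\<lambda>t. h x (of_real t)) has_vector_derivative deriv (h x) 0) (at 0)"
        by (rule has_vector_derivative_real_field)
      moreover have "h x (of_real t) = g (x + t *\<^sub>R \<xi>)" for t
      proof -
        have "complexify x + of_real t *s complexify \<xi> = complexify (x + t *\<^sub>R \<xi>)"
          by (simp add: complexify_def vec_eq_iff)
        then show ?thesis using gH line_in_VV[OF that \<xi>] by (simp add: h_def)
      qed
      ultimately show ?thesis by simp
    qed
    have dd: "dirderiv \<xi> g x = deriv (h x) 0" if "x \<in> VV" for x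
      unfolding dirderiv_def using der[OF that] by (rule vector_derivative_at)
    define P where "P = (\<lambda>(x, z). h x z)"
    have contP: "continuous_on (VV \<times> cball 0 (r/2)) P"
    proof -
      have "continuous_on (VV \<times> cball 0 (r/2)) (\<lambda>u. complexify (fst u) + snd u *s complexify \<xi>)"
        unfolding complexify_def vector_scalar_mult_def by (intro continuous_intros)
      moreover have "(\<lambda>u. complexify (fst u) + snd u *s complexify \<xi>) ` (VV \<times> cball 0 (r/2)) \<subseteq> tube \<Omega>"
      proof clarsimp
        fix x z assume x: "x \<in> VV" and z: "norm (z::complex) * 2 \<le> r"
        have "\<bar>Im z\<bar> < r" using z abs_Im_le_cmod[of z] r by simp
        then show "complexify x + z *s complexify \<xi> \<in> tube \<Omega>"
          by (intro complex_line_in_tube x \<xi> rs)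
      qed
      ultimately have "continuous_on (VV \<times> cball 0 (r/2)) (\<lambda>u. H (complexify (fst u) + snd u *s complexify \<xi>))"
        by (rule continuous_on_compose2[OF contH])
      then show ?thesis by (simp add: P_def h_def case_prod_unfold)
    qed
    have "continuous_on VV (\<lambda>x. deriv (h x) 0)"
      unfolding continuous_on_iff
    proof (intro ballI allI impI)
      fix x \<epsilon> assume x: "x \<in> VV" and \<epsilon>: "\<epsilon> > (0::real)"
      have "closed VV"
        unfolding VV_def by (intro closed_Collect_eq continuous_intros)
      then have "compact ((cball x 1 \<inter> VV) \<times> cball 0 (r/2) :: ((real^3) \<times> complex) set)"
        by (intro compact_Times compact_Int_closed compact_cball)
      moreover have "continuous_on ((cball x 1 \<inter> VV) \<times> cball 0 (r/2)) P"
        by (rule continuous_on_subset[OF contP]) auto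
      ultimately have "uniformly_continuous_on ((cball x 1 \<inter> VV) \<times> cball 0 (r/2)) P"
        by (rule compact_uniformly_continuous[rotated])
      moreover have "\<epsilon> * r / 4 > 0" using \<epsilon> r by simp
      ultimately obtain d where d: "d > 0"
        and dP: "\<And>u v. u \<in> (cball x 1 \<inter> VV) \<times> cball 0 (r/2) \<Longrightarrow> v \<in> (cball x 1 \<inter> VV) \<times> cball 0 (r/2) \<Longrightarrow>
             dist v u < d \<Longrightarrow> dist (P v) (P u) < \<epsilon> * r / 4"
        unfolding uniformly_continuous_on_def by metis
      show "\<exists>d>0. \<forall>y\<in>VV. dist y x < d \<longrightarrow> dist (deriv (h y) 0) (deriv (h x) 0) < \<epsilon>"
      proof (intro exI[of _ "min d 1"] conjI ballI impI)
        show "min d 1 > 0" using d by simp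
        fix y assume y: "y \<in> VV" and yx: "dist y x < min d 1"
        let ?f = "\<lambda>z. h y z - h x z"
        have f: "?f holomorphic_on ball 0 r" using hol[OF y] hol[OF x] by (intro holomorphic_intros)
        have f1: "?f holomorphic_on ball 0 (r/2)"
          by (rule holomorphic_on_subset[OF f]) (use r in auto)
        have f2: "continuous_on (cball 0 (r/2)) ?f"
          by (rule continuous_on_subset[OF holomorphic_on_imp_continuous_on[OF f]]) (use r in auto)
        have "norm ((deriv ^^ 1) ?f 0) \<le> fact 1 * (\<epsilon> * r / 4) / (r/2)^1"
        proof (rule Cauchy_inequality[OF f1 f2])
          show "0 < r / 2" using r by simp
          fix z :: complex assume z: "norm (0 - z) = r / 2"
          have "dist (y, z) (x, z) = dist y x" by (simp add: dist_Pair_Pair)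
          then have "dist (P (y, z)) (P (x, z)) < \<epsilon> * r / 4"
            using yx y x z by (intro dP) (auto simp: dist_commute)
          then show "norm (h y z - h x z) \<le> \<epsilon> * r / 4" by (simp add: P_def dist_norm)
        qed
        moreover have "deriv ?f 0 = deriv (h y) 0 - deriv (h x) 0"
          using hol[OF y] hol[OF x] r
          by (intro deriv_diff) (auto simp: holomorphic_on_imp_differentiable_at)
        ultimately have "dist (deriv (h y) 0) (deriv (h x) 0) \<le> \<epsilon> / 2"
          using r by (simp add: dist_norm field_simps)
        then show "dist (deriv (h y) 0) (deriv (h x) 0) < \<epsilon>" using \<epsilon> by simp
      qed
    qed
    then have "continuous_on VV (dirderiv \<xi> g)" by (subst continuous_on_cong[OF refl dd]) auto
    then show ?thesis using der dd by simp
  qed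
  ultimately show ?thesis unfolding C1_on_VV_def by blast
qed

section \<open>Averages over the orbit\<close>

definition signed_avg :: "((3 \<Rightarrow> 3) \<Rightarrow> real) \<Rightarrow> (real ^ 3 \<Rightarrow> complex) \<Rightarrow> real ^ 3 \<Rightarrow> complex" where
  "signed_avg \<epsilon> g x = (1 / 6) * (\<Sum>w | w permutes UNIV. of_real (\<epsilon> w) * g (perm_act w x))"

lemma signed_avg_has_derivative:
  assumes g: "C1_on_VV g" and x: "x \<in> VV" and \<xi>: "\<xi> \<in> VV"
  shows "((\<lambda>t. signed_avg \<epsilon> g (x + t *\<^sub>R \<xi>)) has_vector_derivative
     (1 / 6) * (\<Sum>w | w permutes UNIV. of_real (\<epsilon> w) * dirderiv (perm_act w \<xi>) g (perm_act w x))) (at 0)"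
  unfolding signed_avg_def perm_act_line
proof (intro has_vector_derivative_mult_right has_vector_derivative_sum)
  fix w :: "3 \<Rightarrow> 3" assume "w \<in> {w. w permutes UNIV}"
  then have "perm_act w x \<in> VV" "perm_act w \<xi> \<in> VV" using x \<xi> by (auto intro: perm_act_in_VV)
  then show "((\<lambda>t. g (perm_act w x + t *\<^sub>R perm_act w \<xi>)) has_vector_derivative
      dirderiv (perm_act w \<xi>) g (perm_act w x)) (at 0)"
    using g unfolding C1_on_VV_def by blast
qed

lemma dirderiv_signed_avg:
  assumes "C1_on_VV g" and "x \<in> VV" and "\<xi> \<in> VV"
  shows "dirderiv \<xi> (signed_avg \<epsilon> g) x =
     (1 / 6) * (\<Sum>w | w permutes UNIV. of_real (\<epsilon> w) * dirderiv (perm_act w \<xi>) g (perm_act w x))"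
  using signed_avg_has_derivative[OF assms] unfolding dirderiv_def by (rule vector_derivative_at)

lemma C1_signed_avg:
  assumes g: "C1_on_VV g"
  shows "C1_on_VV (signed_avg \<epsilon> g)"
proof -
  have orbit: "continuous_on VV (\<lambda>x. f (perm_act w x))"
    if f: "continuous_on VV f" and w: "w permutes UNIV" for f :: "real ^ 3 \<Rightarrow> complex" and w
    using f
  proof (rule continuous_on_compose2)
    show "continuous_on VV (perm_act w)"
      unfolding perm_act_def by (intro continuous_intros)
  qed (use perm_act_in_VV[OF w] in blast)
  have "continuous_on VV (signed_avg \<epsilon> g)"
    unfolding signed_avg_def
    by (intro continuous_intros orbit) (use g in \<open>auto simp: C1_on_VV_def\<close>)
  moreover have "((\<lambda>t. signed_avg \<epsilon> g (x + t *\<^sub>R \<xi>)) has_vector_derivative dirderiv \<xi> (signed_avg \<epsilon> g) x) (at 0)"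
    if "\<xi> \<in> VV" "x \<in> VV" for \<xi> x
    unfolding dirderiv_signed_avg[OF g that(2,1)] by (rule signed_avg_has_derivative[OF g that(2,1)])
  moreover have "continuous_on VV (dirderiv \<xi> (signed_avg \<epsilon> g))" if \<xi>: "\<xi> \<in> VV" for \<xi>
  proof (subst continuous_on_cong[OF refl dirderiv_signed_avg[OF g _ \<xi>]])
    show "continuous_on VV (\<lambda>x. (1 / 6) * (\<Sum>w | w permutes UNIV. of_real (\<epsilon> w) * dirderiv (perm_act w \<xi>) g (perm_act w x)))"
      by (intro continuous_intros orbit) (use g perm_act_in_VV[OF _ \<xi>] in \<open>auto simp: C1_on_VV_def\<close>)
  qed
  ultimately show ?thesis unfolding C1_on_VV_def by blast
qed

section \<open>Dunkl-Cherednik operators near the reflection lines\<close>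

text \<open>
  The points \<open>y\<close> and \<open>s\<^sub>i\<^sub>j y\<close> lie on a line in the direction \<open>e\<^sub>i - e\<^sub>j\<close>, at parameter distance
  \<open>y\<^sub>i - y\<^sub>j\<close>, and both tend to \<open>x\<close>.  Differentiability at \<open>x\<close> would not control a difference between
  two moving points; the mean value inequality does, since the derivative is continuous.
\<close>

lemma C1_strict_derivative:
  assumes f: "C1_on_VV f" and ij: "i \<noteq> j" and x: "x \<in> VV" "x $ i = x $ j"
  shows "((\<lambda>y. (f y - f (perm_act (Transposition.transpose i j) y)) / of_real (y $ i - y $ j))
      \<longlongrightarrow> dirderiv (axis i 1 - axis j 1) f x) (at x within {y \<in> VV. y $ i \<noteq> y $ j})"
  unfolding Lim_within
proof (intro allI impI)
  fix e :: real assume e: "e > 0"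
  let ?a = "axis i 1 - axis j 1 :: real ^ 3" and ?s = "Transposition.transpose i j"
  have a: "?a \<in> VV" using root_in_VV[OF ij] .
  have s: "?s permutes UNIV" by (rule permutes_swap_id) auto
  have "continuous_on VV (dirderiv ?a f)" using f a unfolding C1_on_VV_def by blast
  then obtain d where d: "d > 0"
    and dd: "\<And>y. y \<in> VV \<Longrightarrow> dist y x < d \<Longrightarrow> dist (dirderiv ?a f y) (dirderiv ?a f x) < e / 2"
    unfolding continuous_on_iff using x e by (metis half_gt_zero)
  show "\<exists>d>0. \<forall>y\<in>{y \<in> VV. y $ i \<noteq> y $ j}. 0 < dist y x \<and> dist y x < d \<longrightarrow>
     dist ((f y - f (perm_act ?s y)) / of_real (y $ i - y $ j)) (dirderiv ?a f x) < e"
  proof (intro exI[of _ d] conjI ballI impI d)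
    fix y assume "y \<in> {y \<in> VV. y $ i \<noteq> y $ j}" and "0 < dist y x \<and> dist y x < d"
    then have y: "y \<in> VV" "y $ i \<noteq> y $ j" and yx: "dist y x < d" by auto
    define z where "z = perm_act ?s y"
    define u where "u = y $ i - y $ j"
    have yz: "y = z + u *\<^sub>R ?a" unfolding z_def u_def by (rule transpose_act_decomp[OF ij])
    have z: "z \<in> VV" unfolding z_def by (rule perm_act_in_VV[OF s y(1)])
    have "perm_act ?s x = x" using x(2) by (auto simp: vec_eq_iff Transposition.transpose_def)
    then have "z - x = perm_act ?s (y - x)" by (simp add: z_def perm_act_def vec_eq_iff)
    then have zx: "dist z x < d" using yx norm_perm_act[OF s] by (simp add: dist_norm)
    define \<phi> where "\<phi> t = f (z + t *\<^sub>R ?a)" for t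
    have seg: "dist (z + t *\<^sub>R ?a) x < d" if "t \<in> closed_segment 0 u" for t
    proof -
      obtain v where v: "0 \<le> v" "v \<le> 1" "t = v * u" using \<open>t \<in> closed_segment 0 u\<close>
        by (auto simp: closed_segment_def)
      have "z + t *\<^sub>R ?a = (1 - v) *\<^sub>R z + v *\<^sub>R y"
        by (subst yz) (simp add: v algebra_simps)
      also have "\<dots> \<in> ball x d" using zx yx v
        by (intro convexD_alt) (auto simp: dist_commute)
      finally show ?thesis by (simp add: dist_commute)
    qed
    have der: "(\<phi> has_vector_derivative dirderiv ?a f (z + t *\<^sub>R ?a)) (at t within closed_segment 0 u)" for t
    proof -
      have "((\<lambda>r. f (z + t *\<^sub>R ?a + r *\<^sub>R ?a)) has_vector_derivative dirderiv ?a f (z + t *\<^sub>R ?a)) (at 0)"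
        using f a line_in_VV[OF z a] unfolding C1_on_VV_def by blast
      then have "((\<lambda>r. f (z + t *\<^sub>R ?a + r *\<^sub>R ?a)) has_vector_derivative dirderiv ?a f (z + t *\<^sub>R ?a)) (at (t - t))"
        by simp
      then have "((\<lambda>r. f (z + t *\<^sub>R ?a + r *\<^sub>R ?a)) \<circ> (\<lambda>r. r - t) has_vector_derivative
          1 *\<^sub>R dirderiv ?a f (z + t *\<^sub>R ?a)) (at t)"
        by (rule vector_diff_chain_at[rotated]) (auto intro!: derivative_eq_intros)
      then have "((\<lambda>r. f (z + t *\<^sub>R ?a + (r - t) *\<^sub>R ?a)) has_vector_derivative dirderiv ?a f (z + t *\<^sub>R ?a)) (at t)"
        by (simp add: o_def)
      then show ?thesis
        by (simp add: \<phi>_def[abs_def] algebra_simps has_vector_derivative_at_within)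
    qed
    (* Mean value inequality for phi(t) - t phi'(x): on the segment its derivative is below e/2. *)
    have "norm (\<phi> u - \<phi> 0 - (u - 0) *\<^sub>R dirderiv ?a f x) \<le> norm (u - 0) * (e / 2)"
    proof -
      let ?\<psi> = "\<lambda>t. \<phi> t - t *\<^sub>R dirderiv ?a f x"
      have "norm (?\<psi> u - ?\<psi> 0) \<le> e / 2 * norm (u - 0)"
      proof (rule differentiable_bound[of "closed_segment 0 u" _ "\<lambda>t h. h *\<^sub>R (dirderiv ?a f (z + t *\<^sub>R ?a) - dirderiv ?a f x)"])
        fix t assume t: "t \<in> closed_segment 0 u"
        have "(?\<psi> has_vector_derivative dirderiv ?a f (z + t *\<^sub>R ?a) - dirderiv ?a f x) (at t within closed_segment 0 u)"
          using der[of t] by (auto intro!: derivative_eq_intros)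
        then show "(?\<psi> has_derivative (\<lambda>h. h *\<^sub>R (dirderiv ?a f (z + t *\<^sub>R ?a) - dirderiv ?a f x))) (at t within closed_segment 0 u)"
          by (simp add: has_vector_derivative_def)
        have "norm (dirderiv ?a f (z + t *\<^sub>R ?a) - dirderiv ?a f x) \<le> e / 2"
          using dd[OF line_in_VV[OF z a] seg[OF t]] by (simp add: dist_norm)
        then show "onorm (\<lambda>h. h *\<^sub>R (dirderiv ?a f (z + t *\<^sub>R ?a) - dirderiv ?a f x)) \<le> e / 2"
          by (intro onorm_le) (metis mult.commute mult_right_mono norm_ge_zero norm_scaleR real_norm_def)
      qed auto
      then show ?thesis by (simp add: algebra_simps)
    qed
    then have "norm (f y - f z - u *\<^sub>R dirderiv ?a f x) \<le> \<bar>u\<bar> * (e / 2)"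
      using yz by (simp add: \<phi>_def)
    moreover have "u \<noteq> 0" using y(2) by (simp add: u_def)
    moreover from this have quot: "(f y - f z) / of_real u - dirderiv ?a f x = (f y - f z - u *\<^sub>R dirderiv ?a f x) / of_real u"
      by (simp add: field_simps scaleR_conv_of_real)
    ultimately have "norm ((f y - f z) / of_real u - dirderiv ?a f x) \<le> e / 2"
      unfolding quot norm_divide norm_of_real by (simp add: pos_divide_le_eq mult.commute)
    then show "dist ((f y - f (perm_act ?s y)) / of_real (y $ i - y $ j)) (dirderiv ?a f x) < e"
      using e by (simp add: dist_norm z_def u_def)
  qed
qed

lemma exp_quotient_tendsto: "((\<lambda>u. u / (1 - exp (- u))) \<longlongrightarrow> (1::real)) (at 0)"
proof -
  have "((\<lambda>u::real. 1 - exp (- u)) has_field_derivative 1) (at 0)"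
    by (auto intro!: derivative_eq_intros)
  then have "((\<lambda>u::real. (1 - exp (- u)) / u) \<longlongrightarrow> 1) (at 0)"
    by (simp add: has_field_derivative_iff)
  from tendsto_inverse[OF this] show ?thesis by simp
qed

text \<open>Every short step along a vector with distinct coordinates ends off all reflection lines.\<close>

lemma regular_point_approx:
  assumes x: "x \<in> VV"
  shows "at x within regular_points \<noteq> bot"
proof -
  define v where "v = (vector [1, 0, -1] :: real ^ 3)"
  have v: "v \<in> VV" "\<And>i j. i \<noteq> j \<Longrightarrow> v $ i \<noteq> v $ j"
    subgoal by (simp add: v_def VV_def)
    subgoal for i j using exhaust_3[of i] exhaust_3[of j] by (auto simp: v_def)
    done
  have "\<forall>\<^sub>F t in at_right 0. (x + t *\<^sub>R v) $ i \<noteq> (x + t *\<^sub>R v) $ j" if "i \<noteq> j" for i j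
  proof (cases "x $ i = x $ j")
    case True
    have "\<forall>\<^sub>F t::real in at_right 0. t > 0" by (rule eventually_at_right_less)
    then show ?thesis by eventually_elim (use True v(2)[OF that] in simp)
  next
    case False
    have "((\<lambda>t. x $ i - x $ j + t * (v $ i - v $ j)) \<longlongrightarrow> x $ i - x $ j + 0 * (v $ i - v $ j)) (at_right 0)"
      by (intro tendsto_intros)
    from tendsto_imp_eventually_ne[OF this, of 0] False show ?thesis
      by (auto elim!: eventually_mono simp: algebra_simps)
  qed
  then have "\<forall>\<^sub>F t in at_right 0. x + t *\<^sub>R v \<in> regular_points"
    using line_in_VV[OF x v(1)] unfolding regular_points_def
    by (auto simp: eventually_all_finite)
  moreover have "\<forall>\<^sub>F t::real in at_right 0. t > 0" by (rule eventually_at_right_less)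
  ultimately have ev: "\<forall>\<^sub>F t in at_right 0. x + t *\<^sub>R v \<in> regular_points \<and> x + t *\<^sub>R v \<noteq> x"
    by eventually_elim (use v(2)[of 1 2] in auto)
  have "((\<lambda>t. x + t *\<^sub>R v) \<longlongrightarrow> x + 0 *\<^sub>R v) (at_right 0)"
    by (intro tendsto_intros)
  with ev have "filterlim (\<lambda>t. x + t *\<^sub>R v) (at x within regular_points) (at_right 0)"
    by (simp add: filterlim_at)
  then show ?thesis
    unfolding filterlim_def by (auto simp: filtermap_bot_iff bot_unique)
qed

lemma refl_quot_apart:
  "x $ i \<noteq> x $ j \<Longrightarrow> refl_quot i j f x =
     (f x - f (perm_act (Transposition.transpose i j) x)) / of_real (1 - exp (x $ j - x $ i))"
  by (simp add: refl_quot_def)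

text \<open>
  On the line \<open>x\<^sub>i = x\<^sub>j\<close> the quotient is defined through \<^const>\<open>Lim\<close>, which carries no information
  unless the limit exists.  It does: the factor \<open>u / (1 - exp(-u))\<close> with \<open>u = y\<^sub>i - y\<^sub>j\<close> tends to 1
  and the remaining quotient tends to the derivative along \<open>e\<^sub>i - e\<^sub>j\<close>.
\<close>

lemma refl_quot_tendsto:
  assumes f: "C1_on_VV f" and ij: "i \<noteq> j" and x: "x \<in> VV"
  shows "(refl_quot i j f \<longlongrightarrow> refl_quot i j f x) (at x within regular_points)"
proof -
  let ?s = "Transposition.transpose i j"
  let ?q = "\<lambda>y. (f y - f (perm_act ?s y)) / complex_of_real (1 - exp (y $ j - y $ i))"
  have s: "?s permutes UNIV" by (rule permutes_swap_id) auto
  have reg: "regular_points \<subseteq> {y \<in> VV. y $ i \<noteq> y $ j}" using ij by (auto simp: regular_points_def)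
  have q: "refl_quot i j f y = ?q y" if "y \<in> regular_points" for y
    using that reg by (intro refl_quot_apart) auto
  have "(?q \<longlongrightarrow> refl_quot i j f x) (at x within regular_points)"
  proof (cases "x $ i = x $ j")
    case False
    have f': "continuous_on VV f" using f unfolding C1_on_VV_def by blast
    have "continuous_on VV (\<lambda>y. f (perm_act ?s y))"
      by (rule continuous_on_compose2[OF f'])
         (use perm_act_in_VV[OF s] in \<open>auto simp: perm_act_def intro!: continuous_intros\<close>)
    then have "(?q \<longlongrightarrow> ?q x) (at x within VV)"
      using f' x False unfolding continuous_on_def by (intro tendsto_intros) auto
    then show ?thesis using False reg
      by (auto simp: refl_quot_apart intro: tendsto_within_subset)
  next
    case True
    let ?S = "{y \<in> VV. y $ i \<noteq> y $ j}"
    have S: "{y. y - x \<in> VV \<and> y $ i \<noteq> y $ j} = ?S"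
      using x by (auto simp: VV_def algebra_simps)
    have "filterlim (\<lambda>y. y $ i - y $ j) (at 0) (at x within ?S)"
    proof -
      have "((\<lambda>y. y $ i - y $ j) \<longlongrightarrow> x $ i - x $ j) (at x within ?S)" by (intro tendsto_intros)
      then show ?thesis using True by (auto simp: filterlim_at eventually_at_filter)
    qed
    from filterlim_compose[OF exp_quotient_tendsto this]
    have "((\<lambda>y. complex_of_real ((y $ i - y $ j) / (1 - exp (y $ j - y $ i)))) \<longlongrightarrow> of_real 1) (at x within ?S)"
      by (intro tendsto_of_real) simp
    from tendsto_mult[OF C1_strict_derivative[OF f ij x True] this]
    have "((\<lambda>y. (f y - f (perm_act ?s y)) / of_real (y $ i - y $ j) * complex_of_real ((y $ i - y $ j) / (1 - exp (y $ j - y $ i))))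
       \<longlongrightarrow> dirderiv (axis i 1 - axis j 1) f x) (at x within ?S)" by simp
    then have lim: "(?q \<longlongrightarrow> dirderiv (axis i 1 - axis j 1) f x) (at x within ?S)"
      by (rule Lim_transform_within[OF _ zero_less_one]) auto
    have "at x within ?S \<noteq> bot"
      using regular_point_approx[OF x] at_le[OF reg, of x] by (auto simp: bot_unique)
    then have "refl_quot i j f x = dirderiv (axis i 1 - axis j 1) f x"
      using True lim by (simp add: refl_quot_def S tendsto_Lim)
    then show ?thesis using lim reg by (auto intro: tendsto_within_subset)
  qed
  then show ?thesis
    by (rule Lim_transform_within[of _ _ _ _ 1]) (auto simp: q)
qed

lemma sum_root_pairs:
  "(\<Sum>(i, j)\<in>{(1, 2), (1, 3), (2, 3)}. h i j) = h 1 2 + h 1 3 + h 2 (3 :: 3)"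
  for h :: "3 \<Rightarrow> 3 \<Rightarrow> 'a :: comm_monoid_add"
  by (simp add: add.assoc)

lemma dunkl_cherednik_unfold:
  "dunkl_cherednik k \<xi> f x = dirderiv \<xi> f x
     + k *\<^sub>R (\<Sum>(i, j)\<in>{(1, 2), (1, 3), (2, 3)}. (\<xi> $ i - \<xi> $ j) *\<^sub>R refl_quot i j f x)
     - (rho k \<bullet> \<xi>) *\<^sub>R f x"
  by (simp add: dunkl_cherednik_def dirderiv_def)

lemma dunkl_cherednik_tendsto:
  assumes f: "C1_on_VV f" and \<xi>: "\<xi> \<in> VV" and x: "x \<in> VV"
  shows "(dunkl_cherednik k \<xi> f \<longlongrightarrow> dunkl_cherednik k \<xi> f x) (at x within regular_points)"
proof -
  have sub: "regular_points \<subseteq> VV" by (auto simp: regular_points_def)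
  have lim: "(f \<longlongrightarrow> f x) (at x within regular_points)" "(dirderiv \<xi> f \<longlongrightarrow> dirderiv \<xi> f x) (at x within regular_points)"
    using f \<xi> x tendsto_within_subset[OF _ sub] unfolding C1_on_VV_def continuous_on_def by blast+
  have "(refl_quot i j f \<longlongrightarrow> refl_quot i j f x) (at x within regular_points)"
    if "i \<noteq> j" for i j using refl_quot_tendsto[OF f that x] .
  note q = this
  have "(1::3) \<noteq> 2" "(1::3) \<noteq> 3" "(2::3) \<noteq> 3" by simp_all
  then have q': "(refl_quot 1 2 f \<longlongrightarrow> refl_quot 1 2 f x) (at x within regular_points)"
    "(refl_quot 1 3 f \<longlongrightarrow> refl_quot 1 3 f x) (at x within regular_points)"
    "(refl_quot 2 3 f \<longlongrightarrow> refl_quot 2 3 f x) (at x within regular_points)"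
    using q by blast+
  show ?thesis
    unfolding dunkl_cherednik_unfold sum_root_pairs
    by (intro tendsto_add tendsto_diff tendsto_scaleR tendsto_const lim q')
qed

section \<open>Dunkl-Cherednik operators on orbit averages\<close>

definition root_weight :: "3 \<Rightarrow> 3 \<Rightarrow> real ^ 3 \<Rightarrow> real" where
  "root_weight i j x = 1 / (1 - exp (x $ j - x $ i))"

text \<open>The identity \<open>1/(1 - exp(-u)) + 1/(1 - exp u) = 1\<close>: it lets the exponential weights drop out of the
  sums over the orbit.\<close>

lemma root_weight_swap: "x $ i \<noteq> x $ j \<Longrightarrow> root_weight j i x = 1 - root_weight i j x"
proof -
  assume "x $ i \<noteq> x $ j"
  then have ne: "exp (x $ j - x $ i) \<noteq> 1" by simp
  have "exp (x $ i - x $ j) = 1 / exp (x $ j - x $ i)"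
    using exp_minus[of "x $ j - x $ i"] by (simp add: divide_inverse)
  then have "root_weight j i x = 1 / (1 - 1 / exp (x $ j - x $ i))"
    by (simp add: root_weight_def)
  also have "\<dots> = exp (x $ j - x $ i) / (exp (x $ j - x $ i) - 1)"
    by (simp add: divide_simps)
  also have "\<dots> = 1 - root_weight i j x"
    using ne by (simp add: root_weight_def divide_simps) (simp add: algebra_simps)
  finally show ?thesis .
qed

lemma regular_perm_act:
  assumes w: "w permutes UNIV" and x: "x \<in> regular_points"
  shows "perm_act w x \<in> regular_points"
proof -
  have "inv w i \<noteq> inv w j" if "i \<noteq> j" for i j
    using that injD[OF permutes_inj[OF permutes_inv[OF w]]] by blast
  then show ?thesis using x perm_act_in_VV[OF w] by (auto simp: regular_points_def perm_act_def)
qed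

lemma signed_avg_transpose:
  assumes \<epsilon>: "\<And>w. w permutes UNIV \<Longrightarrow> \<epsilon> (w \<circ> Transposition.transpose i j) = \<eta> * \<epsilon> w"
  shows "signed_avg \<epsilon> g (perm_act (Transposition.transpose i j) x) = of_real \<eta> * signed_avg \<epsilon> g x"
proof -
  let ?s = "Transposition.transpose i j"
  have s: "?s permutes UNIV" by (rule permutes_swap_id) auto
  have "(\<Sum>w | w permutes UNIV. of_real (\<epsilon> w) * g (perm_act w (perm_act ?s x)))
     = (\<Sum>w | w permutes UNIV. of_real \<eta> * (of_real (\<epsilon> w) * g (perm_act w x)))"
  proof (rule sum.reindex_bij_witness[of _ "\<lambda>w. w \<circ> ?s" "\<lambda>w. w \<circ> ?s"])
    fix w assume "w \<in> {w. w permutes (UNIV :: 3 set)}"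
    then have w: "w permutes UNIV" and ws: "w \<circ> ?s permutes UNIV"
      using s by (auto intro: permutes_compose)
    have wss: "(w \<circ> ?s) \<circ> ?s = w" by (simp add: o_assoc[symmetric])
    then show "(w \<circ> ?s) \<circ> ?s = w" "(w \<circ> ?s) \<circ> ?s = w" by auto
    show "w \<circ> ?s \<in> {w. w permutes UNIV}" "w \<circ> ?s \<in> {w. w permutes UNIV}" using ws by auto
    have "\<epsilon> w = \<eta> * \<epsilon> (w \<circ> ?s)" using \<epsilon>[OF ws] wss by simp
    then show "of_real \<eta> * (of_real (\<epsilon> (w \<circ> ?s)) * g (perm_act (w \<circ> ?s) x))
        = of_real (\<epsilon> w) * g (perm_act w (perm_act ?s x))"
      using w s by (simp add: perm_act_compose)
  qed
  then show ?thesis by (simp add: signed_avg_def sum_distrib_left[symmetric])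
qed

text \<open>
  Substituting \<open>s\<^sub>i\<^sub>j w\<close> for \<open>w\<close> in the terms with \<open>g(s\<^sub>i\<^sub>j w x)\<close> multiplies \<open>\<epsilon>\<close> by \<open>\<eta>\<close>, changes the sign
  of \<open>(w\<xi>)\<^sub>i - (w\<xi>)\<^sub>j\<close> and replaces \<open>c\<^sub>i\<^sub>j\<close> by \<open>1 - c\<^sub>i\<^sub>j\<close>.  For \<open>\<eta> = 1\<close> the weight \<open>c\<^sub>i\<^sub>j + \<eta>(1 - c\<^sub>i\<^sub>j)\<close>
  is constant; for \<open>\<eta> = -1\<close> it is \<open>2 c\<^sub>i\<^sub>j - 1\<close>.
\<close>

lemma reflection_sum:
  assumes \<epsilon>: "\<And>w. w permutes UNIV \<Longrightarrow> \<epsilon> (Transposition.transpose i j \<circ> w) = \<eta> * \<epsilon> w"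
    and ij: "i \<noteq> j" and x: "x \<in> regular_points"
  shows "(\<Sum>w | w permutes UNIV. of_real (\<epsilon> w * (perm_act w \<xi> $ i - perm_act w \<xi> $ j) * root_weight i j (perm_act w x)) *
       (g (perm_act w x) - g (perm_act (Transposition.transpose i j) (perm_act w x))))
    = (\<Sum>w | w permutes UNIV. complex_of_real (\<epsilon> w * (perm_act w \<xi> $ i - perm_act w \<xi> $ j) *
        (root_weight i j (perm_act w x) + \<eta> * (1 - root_weight i j (perm_act w x)))) * g (perm_act w x))"
    (is "?L = ?R")
proof -
  let ?s = "Transposition.transpose i j"
  let ?m = "\<lambda>w. \<epsilon> w * (perm_act w \<xi> $ i - perm_act w \<xi> $ j)"
  let ?c = "\<lambda>w. root_weight i j (perm_act w x)"
  have s: "?s permutes UNIV" by (rule permutes_swap_id) auto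
  have m: "?m (?s \<circ> w) * ?c (?s \<circ> w) = - \<eta> * ?m w * (1 - ?c w)" if w: "w permutes UNIV" for w
  proof -
    have "perm_act w x $ i \<noteq> perm_act w x $ j"
      using regular_perm_act[OF w x] ij by (auto simp: regular_points_def)
    then have "root_weight j i (perm_act w x) = 1 - ?c w" by (rule root_weight_swap)
    moreover have "root_weight i j (perm_act ?s (perm_act w x)) = root_weight j i (perm_act w x)"
      by (simp add: root_weight_def)
    ultimately show ?thesis
      using s w by (simp add: perm_act_compose \<epsilon>) (simp add: algebra_simps)
  qed
  have "(\<Sum>w | w permutes UNIV. of_real (?m w * ?c w) * g (perm_act ?s (perm_act w x)))
     = (\<Sum>w | w permutes UNIV. complex_of_real (- \<eta> * ?m w * (1 - ?c w)) * g (perm_act w x))"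
  proof (rule sum.reindex_bij_witness[of _ "\<lambda>w. ?s \<circ> w" "\<lambda>w. ?s \<circ> w"])
    fix w assume "w \<in> {w. w permutes (UNIV :: 3 set)}"
    then have w: "w permutes UNIV" and sw: "?s \<circ> w permutes UNIV"
      using s by (auto intro: permutes_compose)
    have ssw: "?s \<circ> (?s \<circ> w) = w" by (simp add: o_assoc)
    then show "?s \<circ> (?s \<circ> w) = w" "?s \<circ> (?s \<circ> w) = w" by auto
    show "?s \<circ> w \<in> {w. w permutes UNIV}" "?s \<circ> w \<in> {w. w permutes UNIV}" using sw by auto
    show "complex_of_real (- \<eta> * ?m (?s \<circ> w) * (1 - ?c (?s \<circ> w))) * g (perm_act (?s \<circ> w) x)
       = of_real (?m w * ?c w) * g (perm_act ?s (perm_act w x))"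
      using m[OF sw] ssw s w by (simp add: perm_act_compose)
  qed
  then have "?L = (\<Sum>w | w permutes UNIV. of_real (?m w * ?c w) * g (perm_act w x))
      - (\<Sum>w | w permutes UNIV. of_real (- \<eta> * ?m w * (1 - ?c w)) * g (perm_act w x))"
    by (simp add: sum_subtractf right_diff_distrib)
  also have "\<dots> = ?R"
    unfolding sum_subtractf[symmetric] by (intro sum.cong refl) (simp add: algebra_simps)
  finally show ?thesis .
qed

text \<open>
  Both factors change sign when \<open>i\<close> and \<open>j\<close> are interchanged, so the sum over positive roots is half
  of the sum over all pairs, and the latter does not see a relabelling of the coordinates.
\<close>

lemma root_sum_invariant:
  assumes w: "w permutes UNIV" and x: "x \<in> regular_points"
  shows "(\<Sum>(i, j)\<in>{(1, 2), (1, 3), (2, 3)}. (perm_act w \<xi> $ i - perm_act w \<xi> $ j) * (2 * root_weight i j (perm_act w x) - 1))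
     = (\<Sum>(i, j)\<in>{(1, 2), (1, 3), (2, 3)}. (\<xi> $ i - \<xi> $ j) * (2 * root_weight i j x - 1))"
proof -
  let ?\<phi> = "\<lambda>\<xi> x i j. (\<xi> $ i - \<xi> $ j) * (2 * root_weight i j (x :: real ^ 3) - 1)"
  have half: "(\<Sum>i\<in>UNIV. \<Sum>j\<in>UNIV. ?\<phi> \<xi> x i j) = 2 * (\<Sum>(i, j)\<in>{(1, 2), (1, 3), (2, 3)}. ?\<phi> \<xi> x i j)"
    if "x \<in> regular_points" for \<xi> :: "real ^ 3" and x
  proof -
    have "?\<phi> \<xi> x j i = ?\<phi> \<xi> x i j" if "i \<noteq> j" for i j
    proof -
      have "root_weight j i x = 1 - root_weight i j x"
        using \<open>x \<in> regular_points\<close> that by (intro root_weight_swap) (simp add: regular_points_def)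
      then show ?thesis by (simp only:) (simp add: algebra_simps)
    qed
    from this[of 1 2] this[of 1 3] this[of 2 3] show ?thesis by (simp add: sum_3)
  qed
  have bij: "bij_betw (inv w) UNIV UNIV" using w permutes_inv permutes_imp_bij by blast
  have "(\<Sum>i\<in>UNIV. \<Sum>j\<in>UNIV. ?\<phi> (perm_act w \<xi>) (perm_act w x) i j)
     = (\<Sum>i\<in>UNIV. \<Sum>j\<in>UNIV. ?\<phi> \<xi> x (inv w i) (inv w j))"
    by (simp add: perm_act_def root_weight_def)
  also have "\<dots> = (\<Sum>i\<in>UNIV. \<Sum>j\<in>UNIV. ?\<phi> \<xi> x (inv w i) j)"
    by (intro sum.cong refl sum.reindex_bij_betw[OF bij])
  also have "\<dots> = (\<Sum>i\<in>UNIV. \<Sum>j\<in>UNIV. ?\<phi> \<xi> x i j)"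
    by (rule sum.reindex_bij_betw[OF bij])
  finally show ?thesis
    using half[OF x] half[OF regular_perm_act[OF w x]] by simp
qed

text \<open>The positive roots add up to \<open>2(e\<^sub>1 - e\<^sub>3)\<close>.\<close>

lemma sum_positive_roots:
  "k * (\<Sum>(i, j)\<in>{(1, 2), (1, 3), (2, 3)}. \<xi> $ i - \<xi> $ j) = 2 * (rho k \<bullet> \<xi>)" for \<xi> :: "real ^ 3"
  by (simp add: rho_def inner_axis' algebra_simps)

lemma dirderiv_eigenfunction:
  assumes eig: "\<forall>\<xi>\<in>VV. \<forall>x\<in>VV. dunkl_cherednik k \<xi> g x = (lam \<bullet> \<xi>) *\<^sub>R g x"
    and \<xi>: "\<xi> \<in> VV" and y: "y \<in> regular_points"
  shows "dirderiv \<xi> g y = of_real ((lam + rho k) \<bullet> \<xi>) * g y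
    - of_real k * (\<Sum>(i, j)\<in>{(1, 2), (1, 3), (2, 3)}. of_real ((\<xi> $ i - \<xi> $ j) * root_weight i j y) *
        (g y - g (perm_act (Transposition.transpose i j) y)))"
proof -
  have y': "y \<in> VV" and ne: "\<And>i j. i \<noteq> j \<Longrightarrow> y $ i \<noteq> y $ j" using y by (auto simp: regular_points_def)
  have rq: "refl_quot i j g y = of_real (root_weight i j y) * (g y - g (perm_act (Transposition.transpose i j) y))"
    if "i \<noteq> j" for i j
    unfolding refl_quot_apart[OF ne[OF that]] root_weight_def by simp
  have "(1::3) \<noteq> 2" "(1::3) \<noteq> 3" "(2::3) \<noteq> 3" by simp_all
  note rq' = this[THEN rq]
  have "dunkl_cherednik k \<xi> g y = (lam \<bullet> \<xi>) *\<^sub>R g y" using eig \<xi> y' by blast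
  then have "dirderiv \<xi> g y = (lam \<bullet> \<xi>) *\<^sub>R g y + (rho k \<bullet> \<xi>) *\<^sub>R g y
     - k *\<^sub>R (\<Sum>(i, j)\<in>{(1, 2), (1, 3), (2, 3)}. (\<xi> $ i - \<xi> $ j) *\<^sub>R refl_quot i j g y)"
    unfolding dunkl_cherednik_unfold by (simp only: algebra_simps)
  then show ?thesis
    unfolding sum_root_pairs rq' scaleR_conv_of_real inner_add_left of_real_add of_real_mult distrib_right mult.assoc .
qed

text \<open>
  The trivial character satisfies this with \<open>\<eta> = 1\<close> and the sign with \<open>\<eta> = -1\<close>; stating the rule for
  both at once lets the symmetric and the antisymmetric average share one computation.
\<close>

definition reflection_character :: "real \<Rightarrow> ((3 \<Rightarrow> 3) \<Rightarrow> real) \<Rightarrow> bool" where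
  "reflection_character \<eta> \<epsilon> \<longleftrightarrow> (\<forall>w i j. w permutes UNIV \<longrightarrow> i \<noteq> j \<longrightarrow>
     \<epsilon> (Transposition.transpose i j \<circ> w) = \<eta> * \<epsilon> w \<and> \<epsilon> (w \<circ> Transposition.transpose i j) = \<eta> * \<epsilon> w)"

lemma reflection_character_sign: "reflection_character (- 1) (\<lambda>w. of_int (sign w))"
proof -
  have "permutation w" if "w permutes UNIV" for w :: "3 \<Rightarrow> 3"
    using permutes_imp_permutation[OF finite that] .
  then show ?thesis
    by (simp add: reflection_character_def sign_compose permutation_swap_id sign_swap_id)
qed

text \<open>
  After the reindexing of \<open>reflection_sum\<close>, each weight splits as
  \<open>c + \<eta>(1 - c) = (1 + \<eta>)/2 + (1 - \<eta>)/2 (2c - 1)\<close>.  The first part sums to a multiple of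
  \<open>\<langle>\<rho>, w\<xi>\<rangle>\<close>.  The second sums to a quantity \<open>I\<close> independent of \<open>w\<close>, which cancels against
  the reflection terms of the operator itself, where \<open>(1 - s\<^sub>i\<^sub>j) F\<^sub>\<epsilon> = (1 - \<eta>) F\<^sub>\<epsilon>\<close>.
\<close>

lemma dunkl_cherednik_signed_avg:
  assumes \<epsilon>: "reflection_character \<eta> \<epsilon>"
    and g: "C1_on_VV g"
    and eig: "\<forall>\<xi>\<in>VV. \<forall>x\<in>VV. dunkl_cherednik k \<xi> g x = (lam \<bullet> \<xi>) *\<^sub>R g x"
    and \<xi>: "\<xi> \<in> VV" and x: "x \<in> regular_points"
  shows "dunkl_cherednik k \<xi> (signed_avg \<epsilon> g) x =
    (1 / 6) * (\<Sum>w | w permutes UNIV. of_real (\<epsilon> w * ((lam - \<eta> *\<^sub>R rho k) \<bullet> perm_act w \<xi> - \<eta> * (rho k \<bullet> \<xi>)))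
       * g (perm_act w x))"
proof -
  have xV: "x \<in> VV" and ne: "\<And>i j. i \<noteq> j \<Longrightarrow> x $ i \<noteq> x $ j" using x by (auto simp: regular_points_def)
  let ?F = "signed_avg \<epsilon> g"
  define I where "I = (\<Sum>(i, j)\<in>{(1, 2), (1, 3), (2, 3)}. (\<xi> $ i - \<xi> $ j) * (2 * root_weight i j x - 1))"
  define d where "d w i j = perm_act w \<xi> $ i - perm_act w \<xi> $ j" for w i j
  define c where "c w i j = root_weight i j (perm_act w x)" for w i j
  define gw where "gw w = g (perm_act w x)" for w
  define A where "A w = (lam + rho k) \<bullet> perm_act w \<xi>" for w
  define R where "R i j w = complex_of_real (\<epsilon> w * d w i j * c w i j) *
      (gw w - g (perm_act (Transposition.transpose i j) (perm_act w x)))" for i j w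
  define Q where "Q i j w = complex_of_real (\<epsilon> w * d w i j * (c w i j + \<eta> * (1 - c w i j))) * gw w" for i j w
  have RQ: "(\<Sum>w | w permutes UNIV. R i j w) = (\<Sum>w | w permutes UNIV. Q i j w)" if "i \<noteq> j" for i j
    unfolding R_def Q_def d_def c_def gw_def
    by (rule reflection_sum[OF _ that x]) (use \<epsilon> that in \<open>auto simp: reflection_character_def\<close>)
  have "(1::3) \<noteq> 2" "(1::3) \<noteq> 3" "(2::3) \<noteq> 3" by simp_all
  note RQ' = this[THEN RQ]
  have der: "dirderiv \<xi> ?F x = (1 / 6) * (\<Sum>w | w permutes UNIV.
      of_real (\<epsilon> w * (A w - (1 + \<eta>) * (rho k \<bullet> perm_act w \<xi>) - (1 - \<eta>) / 2 * k * I)) * gw w)"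
  proof -
    have "(\<Sum>w | w permutes UNIV. of_real (\<epsilon> w) * dirderiv (perm_act w \<xi>) g (perm_act w x))
      = (\<Sum>w | w permutes UNIV. of_real (\<epsilon> w * A w) * gw w - of_real k * (R 1 2 w + R 1 3 w + R 2 3 w))"
    proof (rule sum.cong[OF refl])
      fix w assume "w \<in> {w. w permutes (UNIV :: 3 set)}"
      then have w: "w permutes UNIV" by simp
      show "of_real (\<epsilon> w) * dirderiv (perm_act w \<xi>) g (perm_act w x)
        = of_real (\<epsilon> w * A w) * gw w - of_real k * (R 1 2 w + R 1 3 w + R 2 3 w)"
        unfolding dirderiv_eigenfunction[OF eig perm_act_in_VV[OF w \<xi>] regular_perm_act[OF w x]] sum_root_pairs
          A_def R_def gw_def d_def c_def of_real_mult
        by (simp only: ring_distribs mult_ac)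
    qed
    also have "\<dots> = (\<Sum>w | w permutes UNIV. of_real (\<epsilon> w * A w) * gw w - of_real k * (Q 1 2 w + Q 1 3 w + Q 2 3 w))"
      by (simp add: sum_subtractf sum.distrib sum_distrib_left[symmetric] RQ')
    also have "\<dots> = (\<Sum>w | w permutes UNIV.
      of_real (\<epsilon> w * (A w - (1 + \<eta>) * (rho k \<bullet> perm_act w \<xi>) - (1 - \<eta>) / 2 * k * I)) * gw w)"
    proof (rule sum.cong[OF refl])
      fix w assume "w \<in> {w. w permutes (UNIV :: 3 set)}"
      then have w: "w permutes UNIV" by simp
      have pos: "k * (d w 1 2 + d w 1 3 + d w 2 3) = 2 * (rho k \<bullet> perm_act w \<xi>)"
        using sum_positive_roots[of k "perm_act w \<xi>"] unfolding sum_root_pairs d_def .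
      have inv: "d w 1 2 * (2 * c w 1 2 - 1) + d w 1 3 * (2 * c w 1 3 - 1) + d w 2 3 * (2 * c w 2 3 - 1) = I"
        using root_sum_invariant[OF w x, of \<xi>] unfolding sum_root_pairs d_def c_def I_def .
      have split: "d w i j * (c w i j + \<eta> * (1 - c w i j))
         = (1 + \<eta>) / 2 * d w i j + (1 - \<eta>) / 2 * (d w i j * (2 * c w i j - 1))" for i j
        by (simp add: field_simps)
      have "k * (d w 1 2 * (c w 1 2 + \<eta> * (1 - c w 1 2)) + d w 1 3 * (c w 1 3 + \<eta> * (1 - c w 1 3))
           + d w 2 3 * (c w 2 3 + \<eta> * (1 - c w 2 3)))
         = (1 + \<eta>) / 2 * (k * (d w 1 2 + d w 1 3 + d w 2 3)) + (1 - \<eta>) / 2 * k * I"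
        unfolding split inv[symmetric] by (simp only: ring_distribs mult_ac)
      then have coeff: "k * (d w 1 2 * (c w 1 2 + \<eta> * (1 - c w 1 2)) + d w 1 3 * (c w 1 3 + \<eta> * (1 - c w 1 3))
           + d w 2 3 * (c w 2 3 + \<eta> * (1 - c w 2 3)))
         = (1 + \<eta>) * (rho k \<bullet> perm_act w \<xi>) + (1 - \<eta>) / 2 * k * I"
        unfolding pos by simp
      have "of_real (\<epsilon> w * A w) * gw w - of_real k * (Q 1 2 w + Q 1 3 w + Q 2 3 w)
         = of_real (\<epsilon> w * (A w - k * (d w 1 2 * (c w 1 2 + \<eta> * (1 - c w 1 2))
             + d w 1 3 * (c w 1 3 + \<eta> * (1 - c w 1 3)) + d w 2 3 * (c w 2 3 + \<eta> * (1 - c w 2 3))))) * gw w"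
        unfolding Q_def of_real_mult of_real_add of_real_diff by (simp only: ring_distribs mult_ac)
      then show "of_real (\<epsilon> w * A w) * gw w - of_real k * (Q 1 2 w + Q 1 3 w + Q 2 3 w)
        = of_real (\<epsilon> w * (A w - (1 + \<eta>) * (rho k \<bullet> perm_act w \<xi>) - (1 - \<eta>) / 2 * k * I)) * gw w"
        unfolding coeff by (simp add: diff_diff_eq)
    qed
    finally show ?thesis unfolding dirderiv_signed_avg[OF g xV \<xi>] by simp
  qed
  have rq: "refl_quot i j ?F x = of_real ((1 - \<eta>) * root_weight i j x) * ?F x" if "i \<noteq> j" for i j
  proof -
    have "?F (perm_act (Transposition.transpose i j) x) = of_real \<eta> * ?F x"
      by (rule signed_avg_transpose) (use \<epsilon> that in \<open>auto simp: reflection_character_def\<close>)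
    then show ?thesis
      unfolding refl_quot_apart[OF ne[OF that]] root_weight_def by (simp add: left_diff_distrib)
  qed
  have "(1::3) \<noteq> 2" "(1::3) \<noteq> 3" "(2::3) \<noteq> 3" by simp_all
  note rq' = this[THEN rq]
  (* The reflection terms of the operator contain the same quantity I, with the opposite sign. *)
  have wsum: "k * ((\<xi> $ 1 - \<xi> $ 2) * root_weight 1 2 x + (\<xi> $ 1 - \<xi> $ 3) * root_weight 1 3 x
      + (\<xi> $ 2 - \<xi> $ 3) * root_weight 2 3 x) = k * I / 2 + rho k \<bullet> \<xi>"
  proof -
    have "k * I = 2 * (k * ((\<xi> $ 1 - \<xi> $ 2) * root_weight 1 2 x + (\<xi> $ 1 - \<xi> $ 3) * root_weight 1 3 x
        + (\<xi> $ 2 - \<xi> $ 3) * root_weight 2 3 x))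
        - k * ((\<xi> $ 1 - \<xi> $ 2) + (\<xi> $ 1 - \<xi> $ 3) + (\<xi> $ 2 - \<xi> $ 3))"
      unfolding I_def sum_root_pairs by (simp add: algebra_simps)
    then show ?thesis
      unfolding sum_positive_roots[of k \<xi>, unfolded sum_root_pairs] by linarith
  qed
  have "k *\<^sub>R (\<Sum>(i, j)\<in>{(1, 2), (1, 3), (2, 3)}. (\<xi> $ i - \<xi> $ j) *\<^sub>R refl_quot i j ?F x)
     = of_real ((1 - \<eta>) * (k * ((\<xi> $ 1 - \<xi> $ 2) * root_weight 1 2 x + (\<xi> $ 1 - \<xi> $ 3) * root_weight 1 3 x
      + (\<xi> $ 2 - \<xi> $ 3) * root_weight 2 3 x))) * ?F x"
    unfolding sum_root_pairs rq' scaleR_conv_of_real of_real_mult of_real_add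
    by (simp only: ring_distribs mult_ac)
  then have refl: "k *\<^sub>R (\<Sum>(i, j)\<in>{(1, 2), (1, 3), (2, 3)}. (\<xi> $ i - \<xi> $ j) *\<^sub>R refl_quot i j ?F x)
     = of_real ((1 - \<eta>) * (k * I / 2 + rho k \<bullet> \<xi>)) * ?F x" unfolding wsum .
  have F: "?F x = (1 / 6) * (\<Sum>w | w permutes UNIV. of_real (\<epsilon> w) * gw w)"
    by (simp add: signed_avg_def gw_def)
  define K where "K = (1 - \<eta>) * (k * I / 2 + rho k \<bullet> \<xi>) - rho k \<bullet> \<xi>"
  have "dunkl_cherednik k \<xi> ?F x = dirderiv \<xi> ?F x + of_real K * ?F x"
    unfolding dunkl_cherednik_unfold refl by (simp add: K_def scaleR_conv_of_real algebra_simps)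
  also have "\<dots> = (1 / 6) * (\<Sum>w | w permutes UNIV.
      of_real (\<epsilon> w * (A w - (1 + \<eta>) * (rho k \<bullet> perm_act w \<xi>) - (1 - \<eta>) / 2 * k * I)) * gw w
      + of_real K * (of_real (\<epsilon> w) * gw w))"
    unfolding der F sum.distrib sum_distrib_left by (simp add: algebra_simps sum_distrib_left)
  also have "\<dots> = (1 / 6) * (\<Sum>w | w permutes UNIV.
      of_real (\<epsilon> w * ((lam - \<eta> *\<^sub>R rho k) \<bullet> perm_act w \<xi> - \<eta> * (rho k \<bullet> \<xi>))) * gw w)"
  proof -
    have "(lam - \<eta> *\<^sub>R rho k) \<bullet> perm_act w \<xi> - \<eta> * (rho k \<bullet> \<xi>)
       = A w - (1 + \<eta>) * (rho k \<bullet> perm_act w \<xi>) - (1 - \<eta>) / 2 * k * I + K" for w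
      by (simp add: A_def K_def inner_diff_left inner_add_left field_simps)
    then show ?thesis
      by (simp only: of_real_mult of_real_add ring_distribs mult_ac)
  qed
  finally show ?thesis unfolding gw_def .
qed

section \<open>The operators of the theorem on orbit averages\<close>

text \<open>The common form of \<^const>\<open>Dop\<close> (for \<open>\<eta> = 1\<close>) and \<^const>\<open>Dop_star\<close> (for \<open>\<eta> = -1\<close>).\<close>

definition Dop_char :: "real \<Rightarrow> real \<Rightarrow> real ^ 3 \<Rightarrow> (real ^ 3 \<Rightarrow> complex) \<Rightarrow> real ^ 3 \<Rightarrow> complex" where
  "Dop_char \<eta> k lam f x =
     (lam $ 1 - lam $ 3 + 2 * (\<eta> * k)) *\<^sub>R dunkl_cherednik k (proj_VV (axis 1 1)) f x
     + (lam $ 2 - lam $ 3 + \<eta> * k) *\<^sub>R dunkl_cherednik k (proj_VV (axis 2 1)) f x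
     + (tau lam + \<eta> * k * (lam $ 1 - lam $ 3) + k\<^sup>2) *\<^sub>R f x"

lemma proj_VV_decomp:
  assumes "v \<in> VV"
  shows "v = (v $ 1 - v $ 3) *\<^sub>R proj_VV (axis 1 1) + (v $ 2 - v $ 3) *\<^sub>R proj_VV (axis 2 1)"
proof -
  have "v $ 3 = - v $ 1 - v $ 2" using assms by (simp add: VV_def algebra_simps)
  then show ?thesis
    by (simp add: proj_VV_axis vec_eq_iff forall_3 vector_3 field_simps)
qed

text \<open>
  By the previous lemma the first-order part is the operator in the direction
  \<open>\<mu> = \<lambda> + \<eta>\<rho>\<close>.  The constant \<open>-\<eta>\<langle>\<rho>, \<mu>\<rangle>\<close> that it produces turns the zeroth-order
  term into \<open>\<tau>(\<lambda>) - k\<^sup>2\<close>.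
\<close>

lemma Dop_char_signed_avg:
  assumes \<epsilon>: "reflection_character \<eta> \<epsilon>" and \<eta>: "\<eta> * \<eta> = 1"
    and lam: "lam \<in> VV"
    and g: "C1_on_VV g"
    and eig: "\<forall>\<xi>\<in>VV. \<forall>x\<in>VV. dunkl_cherednik k \<xi> g x = (lam \<bullet> \<xi>) *\<^sub>R g x"
    and x: "x \<in> regular_points"
  shows "Dop_char \<eta> k lam (signed_avg \<epsilon> g) x =
    (1 / 6) * (\<Sum>w | w permutes UNIV. of_real (\<epsilon> w *
        ((lam - \<eta> *\<^sub>R rho k) \<bullet> perm_act w (lam + \<eta> *\<^sub>R rho k) + tau lam - k\<^sup>2)) * g (perm_act w x))"
proof -
  let ?\<mu> = "lam + \<eta> *\<^sub>R rho k"
  let ?a = "lam $ 1 - lam $ 3 + 2 * (\<eta> * k)" and ?b = "lam $ 2 - lam $ 3 + \<eta> * k"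
    and ?c = "tau lam + \<eta> * k * (lam $ 1 - lam $ 3) + k\<^sup>2"
  let ?p = "proj_VV (axis 1 1)" and ?q = "proj_VV (axis 2 1)"
  have rho: "rho k $ 1 = k" "rho k $ 2 = 0" "rho k $ 3 = - k"
    by (simp_all add: rho_def axis_def)
  have "?\<mu> \<in> VV" using lam by (simp add: VV_def rho)
  from proj_VV_decomp[OF this] have \<mu>: "?\<mu> = ?a *\<^sub>R ?p + ?b *\<^sub>R ?q"
    by (simp add: rho algebra_simps)
  have const: "?c - \<eta> * (rho k \<bullet> ?\<mu>) = tau lam - k\<^sup>2"
  proof -
    have "\<eta> * (rho k \<bullet> ?\<mu>) = \<eta> * k * (lam $ 1 - lam $ 3) + \<eta> * \<eta> * (2 * k\<^sup>2)"
      by (simp add: inner_vec_def sum_3 rho power2_eq_square algebra_simps)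
    then show ?thesis using \<eta> by simp
  qed
  define m where "m w \<xi> = (lam - \<eta> *\<^sub>R rho k) \<bullet> perm_act w \<xi> - \<eta> * (rho k \<bullet> \<xi>)" for w \<xi>
  have lin: "?a * m w ?p + ?b * m w ?q + ?c = (lam - \<eta> *\<^sub>R rho k) \<bullet> perm_act w ?\<mu> + tau lam - k\<^sup>2" for w
  proof -
    have "perm_act w (?a *\<^sub>R ?p + ?b *\<^sub>R ?q) = ?a *\<^sub>R perm_act w ?p + ?b *\<^sub>R perm_act w ?q"
      by (simp add: perm_act_def vec_eq_iff)
    then have "?a * m w ?p + ?b * m w ?q = m w ?\<mu>"
      unfolding \<mu> m_def by (simp only: inner_add_right inner_scaleR_right ring_distribs mult_ac)
    then show ?thesis using const by (simp add: m_def)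
  qed
  note T = dunkl_cherednik_signed_avg[OF \<epsilon> g eig proj_VV_in x, folded m_def]
  have "Dop_char \<eta> k lam (signed_avg \<epsilon> g) x = (1 / 6) * (\<Sum>w | w permutes UNIV.
      of_real ?a * (of_real (\<epsilon> w * m w ?p) * g (perm_act w x))
      + of_real ?b * (of_real (\<epsilon> w * m w ?q) * g (perm_act w x))
      + of_real ?c * (of_real (\<epsilon> w) * g (perm_act w x)))"
    unfolding Dop_char_def T scaleR_conv_of_real signed_avg_def sum.distrib
    by (simp only: sum_distrib_left[symmetric]) (simp only: ring_distribs mult_ac)
  also have "\<dots> = (1 / 6) * (\<Sum>w | w permutes UNIV. of_real (\<epsilon> w * (?a * m w ?p + ?b * m w ?q + ?c)) * g (perm_act w x))"
    by (intro arg_cong[where f = "\<lambda>s. 1 / 6 * s"] sum.cong refl)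
       (simp only: of_real_mult of_real_add of_real_diff ring_distribs mult_ac)
  finally show ?thesis unfolding lin .
qed

lemma Dop_char_tendsto:
  assumes f: "C1_on_VV f" and x: "x \<in> VV"
  shows "(Dop_char \<eta> k lam f \<longlongrightarrow> Dop_char \<eta> k lam f x) (at x within regular_points)"
proof -
  have "(f \<longlongrightarrow> f x) (at x within regular_points)"
    using f x unfolding C1_on_VV_def continuous_on_def
    by (auto simp: regular_points_def intro: tendsto_within_subset)
  then show ?thesis
    unfolding Dop_char_def
    by (intro tendsto_add tendsto_scaleR tendsto_const dunkl_cherednik_tendsto f x proj_VV_in)
qed

section \<open>The six coefficients\<close>

lemma transpose_3_simps:
  "Transposition.transpose 1 2 (1::3) = 2" "Transposition.transpose 1 2 (2::3) = 1" "Transposition.transpose 1 2 (3::3) = 3"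
  "Transposition.transpose 1 3 (1::3) = 3" "Transposition.transpose 1 3 (2::3) = 2" "Transposition.transpose 1 3 (3::3) = 1"
  "Transposition.transpose 2 3 (1::3) = 1" "Transposition.transpose 2 3 (2::3) = 3" "Transposition.transpose 2 3 (3::3) = 2"
  by (simp_all add: Transposition.transpose_def)

lemma permutes_3_cases:
  fixes w :: "3 \<Rightarrow> 3"
  assumes "w permutes UNIV"
  shows "w = id \<or> w = Transposition.transpose 1 2 \<or> w = Transposition.transpose 1 3 \<or> w = Transposition.transpose 2 3
    \<or> w = Transposition.transpose 1 2 \<circ> Transposition.transpose 2 3
    \<or> w = Transposition.transpose 2 3 \<circ> Transposition.transpose 1 2"
proof -
  have "inj w" using assms by (rule permutes_inj)
  moreover have ne: "(1::3) \<noteq> 2" "(1::3) \<noteq> 3" "(2::3) \<noteq> 3" by simp_all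
  ultimately have "w 1 \<noteq> w 2" "w 1 \<noteq> w 3" "w 2 \<noteq> w 3" by (meson injD)+
  then have "w 1 = 1 \<and> w 2 = 2 \<and> w 3 = 3 \<or> w 1 = 2 \<and> w 2 = 1 \<and> w 3 = 3 \<or> w 1 = 3 \<and> w 2 = 2 \<and> w 3 = 1
     \<or> w 1 = 1 \<and> w 2 = 3 \<and> w 3 = 2 \<or> w 1 = 2 \<and> w 2 = 3 \<and> w 3 = 1 \<or> w 1 = 3 \<and> w 2 = 1 \<and> w 3 = 2"
    using exhaust_3[of "w 1"] exhaust_3[of "w 2"] exhaust_3[of "w 3"] by metis
  then show ?thesis
    by (simp only: fun_eq_iff forall_3 o_apply id_apply transpose_3_simps)
qed

text \<open>
  Reflections are self-adjoint, so their two inner products agree and enter with opposite signs.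
  A rotation \<open>w\<close> by 120 degrees satisfies \<open>\<langle>v, w v\<rangle> = -|v|\<^sup>2/2\<close> in the plane, whence the two inner
  products add up to \<open>|\<rho>|\<^sup>2 - |\<lambda>|\<^sup>2 = 2k\<^sup>2 - 2\<tau>(\<lambda>)\<close>.
\<close>

lemma orbit_coefficient:
  assumes lam: "lam \<in> VV" and w: "w permutes UNIV"
  shows "(lam - rho k) \<bullet> perm_act w (lam + rho k) + tau lam - k\<^sup>2
     + sign w * ((lam + rho k) \<bullet> perm_act w (lam - rho k) + tau lam - k\<^sup>2)
     = (if w = id then 6 * (tau lam - k\<^sup>2) else 0)"
proof -
  have rho: "rho k $ 1 = k" "rho k $ 2 = 0" "rho k $ 3 = - k"
    by (simp_all add: rho_def axis_def)
  have l3: "lam $ 3 = - lam $ 1 - lam $ 2" using lam by (simp add: VV_def algebra_simps)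
  have bij: "bij (Transposition.transpose a b)" for a b :: 3 by simp
  have perm: "permutation (Transposition.transpose a b)" for a b :: 3 by (rule permutation_swap_id)
  have ne: "Transposition.transpose 1 2 \<noteq> (id :: 3 \<Rightarrow> 3)" "Transposition.transpose 1 3 \<noteq> (id :: 3 \<Rightarrow> 3)"
    "Transposition.transpose 2 3 \<noteq> (id :: 3 \<Rightarrow> 3)"
    "Transposition.transpose 1 2 \<circ> Transposition.transpose 2 3 \<noteq> (id :: 3 \<Rightarrow> 3)"
    "Transposition.transpose 2 3 \<circ> Transposition.transpose 1 2 \<noteq> (id :: 3 \<Rightarrow> 3)"
    by (auto simp: fun_eq_iff forall_3 Transposition.transpose_def)
  show ?thesis
    using permutes_3_cases[OF w]
    by (elim disjE; simp add: ne perm_act_def inner_vec_def sum_3 rho sign_swap_id sign_compose perm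
          o_inv_distrib bij tau_def l3 transpose_3_simps power2_eq_square algebra_simps)
qed

section \<open>The reconstruction formula\<close>

theorem theorem3p3:
  fixes k :: real and lam x :: "real ^ 3" and G :: "real ^ 3 \<Rightarrow> real ^ 3 \<Rightarrow> complex"
  assumes "k > 0"
    and "lam \<in> VV"
    and "x \<in> VV"
    and "is_opdam_G k lam (G lam)"
  shows "(tau lam - k\<^sup>2) *\<^sub>R G lam x
           = Dop k lam (sym_avg (G lam)) x + Dop_star k lam (antisym_avg (G lam)) x"
proof -
  let ?g = "G lam" and ?one = "\<lambda>w :: 3 \<Rightarrow> 3. 1 :: real" and ?sgn = "\<lambda>w :: 3 \<Rightarrow> 3. of_int (sign w) :: real"
  have g: "C1_on_VV ?g" by (rule opdam_G_C1[OF assms(4)])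
  have eig: "\<forall>\<xi>\<in>VV. \<forall>x\<in>VV. dunkl_cherednik k \<xi> ?g x = (lam \<bullet> \<xi>) *\<^sub>R ?g x"
    using assms(4) unfolding is_opdam_G_def by blast
  have one: "reflection_character 1 ?one" by (simp add: reflection_character_def)
  note sgn = reflection_character_sign
  have avg: "sym_avg ?g = signed_avg ?one ?g" "antisym_avg ?g = signed_avg ?sgn ?g"
    by (auto simp: sym_avg_def antisym_avg_def signed_avg_def)
  have D: "Dop k lam = Dop_char 1 k lam" "Dop_star k lam = Dop_char (- 1) k lam"
    by (simp_all add: fun_eq_iff Dop_def Dop_star_def Dop_char_def)
  let ?rhs = "\<lambda>x. Dop k lam (sym_avg ?g) x + Dop_star k lam (antisym_avg ?g) x"
  have regular: "(tau lam - k\<^sup>2) *\<^sub>R ?g y = ?rhs y" if y: "y \<in> regular_points" for y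
  proof -
    have "?rhs y = (1 / 6) * (\<Sum>w | w permutes UNIV.
        of_real ((lam - rho k) \<bullet> perm_act w (lam + rho k) + tau lam - k\<^sup>2
     + sign w * ((lam + rho k) \<bullet> perm_act w (lam - rho k) + tau lam - k\<^sup>2)) * ?g (perm_act w y))"
    proof -
      have "Dop_char 1 k lam (signed_avg ?one ?g) y = (1 / 6) * (\<Sum>w | w permutes UNIV.
          of_real (1 * ((lam - 1 *\<^sub>R rho k) \<bullet> perm_act w (lam + 1 *\<^sub>R rho k) + tau lam - k\<^sup>2))
            * ?g (perm_act w y))"
        by (rule Dop_char_signed_avg[OF one _ assms(2) g eig y]) simp
      moreover have "Dop_char (- 1) k lam (signed_avg ?sgn ?g) y = (1 / 6) * (\<Sum>w | w permutes UNIV.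
          of_real (?sgn w * ((lam - (- 1) *\<^sub>R rho k) \<bullet> perm_act w (lam + (- 1) *\<^sub>R rho k) + tau lam - k\<^sup>2))
            * ?g (perm_act w y))"
        by (rule Dop_char_signed_avg[OF sgn _ assms(2) g eig y]) simp
      ultimately show ?thesis
        unfolding avg D
        by (simp only: of_real_add distrib_right sum.distrib distrib_left mult_1 scaleR_one
              scaleR_minus_left diff_minus_eq_add add_uminus_conv_diff)
    qed
    also have "\<dots> = (1 / 6) * (\<Sum>w | w permutes UNIV.
        if w = id then of_real (6 * (tau lam - k\<^sup>2)) * ?g (perm_act w y) else 0)"
      by (intro arg_cong[where f = "\<lambda>s. 1 / 6 * s"] sum.cong refl)
         (simp add: orbit_coefficient[OF assms(2)] del: of_real_add)
    also have "\<dots> = of_real (tau lam - k\<^sup>2) * ?g y"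
      by (simp add: permutes_id perm_act_def)
    finally show ?thesis by (simp add: scaleR_conv_of_real)
  qed
  have "(?rhs \<longlongrightarrow> ?rhs x) (at x within regular_points)"
    unfolding D avg by (intro tendsto_add Dop_char_tendsto C1_signed_avg g assms(3))
  moreover have "(?rhs \<longlongrightarrow> (tau lam - k\<^sup>2) *\<^sub>R ?g x) (at x within regular_points)"
  proof (rule Lim_transform_within[OF _ zero_less_one])
    have "(?g \<longlongrightarrow> ?g x) (at x within regular_points)"
      using g assms(3) unfolding C1_on_VV_def continuous_on_def
      by (auto simp: regular_points_def intro: tendsto_within_subset)
    then show "((\<lambda>y. (tau lam - k\<^sup>2) *\<^sub>R ?g y) \<longlongrightarrow> (tau lam - k\<^sup>2) *\<^sub>R ?g x) (at x within regular_points)"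
      by (intro tendsto_scaleR tendsto_const)
  qed (rule regular)
  ultimately show ?thesis
    using tendsto_unique[OF regular_point_approx[OF assms(3)]] by blast
qed

end
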